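(* Let $t$ and $u$ be terms. If $t\equiv u$ then for every stack $\pi$ and every substitution $\sigma$ we have $t\sigma\ast\pi\Downarrow_{\rightsquigarrow}\Leftrightarrow u\sigma\ast\pi\Downarrow_{\rightsquigarrow}$.
   Context: Fix pairwise disjoint countably infinite sets of $\lambda$-variables ($x,y,\dots$), stack variables ($\alpha,\beta,\dots$), term variables ($a,b,\dots$), and countable sets of labels $l$ and constructors $C$. Values, terms, stacks, processes: $v,w::=x\mid\lambda x\,t\mid C[v]\mid\{l_i=v_i\}_{i\in I}$; $t,u::=a\mid v\mid t\,u\mid\mu\alpha\,t\mid p\mid v.l\mid\mathrm{case}_v[C_i[x_i]\to t_i]_{i\in I}\mid\delta_{v,w}$; $\pi::=\alpha\mid v.\pi\mid[t]\pi$; $p::=t\ast\pi$; $I$ finite; $\lambda x$, $\mu\alpha$ and the $x_i$ in case branches are binders, term variables are never bound. Substitutions map $\lambda$-variables to values, stack variables to stacks, term variables to terms (capture-avoiding). $\succ$ is the smallest relation on processes with: $t\,u\ast\pi\succ u\ast[t]\pi$; $v\ast[t]\pi\succ t\ast v.\pi$; $\lambda x\,t\ast v.\pi\succ t[x:=v]\ast\pi$; $\mu\alpha\,t\ast\pi\succ t[\alpha:=\pi]\ast\pi$; $p\ast\pi\succ p$; $\{l_i=v_i\}_{i\in I}.l_k\ast\pi\succ v_k\ast\pi$ ($k\in I$); $\mathrm{case}_{C_k[v]}[C_i[x_i]\to t_i]_{i\in I}\ast\pi\succ t_k[x_k:=v]\ast\pi$ ($k\in I$). A process is final if it is $v\ast\alpha$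 with $v$ a value and $\alpha$ a stack variable; for a relation $R$, $p\Downarrow_R$ means $p\,R^*\,q$ with $q$ final. For $i\in\mathbb N$, inductively: $\rightsquigarrow_i=\succ\cup\{(\delta_{v,w}\ast\pi,v\ast\pi)\mid\exists j<i,\ v\not\equiv_jw\}$; $t\equiv_iu$ iff for all $j\le i$, stacks $\pi$, substitutions $\sigma$: $t\sigma\ast\pi\Downarrow_{\rightsquigarrow_j}\Leftrightarrow u\sigma\ast\pi\Downarrow_{\rightsquigarrow_j}$; $\not\equiv_i$ is its negation. $\rightsquigarrow=\bigcup_i\rightsquigarrow_i$, $\equiv=\bigcap_i\equiv_i$. *)

theory Defs
  imports Main "HOL-Library.Finite_Map" "HOL-Library.Countable"
begin

(* Expressions up to alpha-equivalence, in de Bruijn representation.  The lambda-variables and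
   the stack variables live in two independent index spaces, so that Lam and every branch of
   Case bind lambda-index 0 (and leave the stack indices alone) while Mu binds stack index 0
   (and leaves the lambda indices alone).  Term variables are never bound, so their indices
   are plain names.  A finite family indexed by pairwise distinct labels or constructors is a
   finite map. *)

datatype ('l, 'c) val =
    LVar nat
  | Lam "('l, 'c) trm"
  | Con 'c "('l, 'c) val"
  | Rcd "('l, ('l, 'c) val) fmap"
and ('l, 'c) trm =
    TVar nat
  | Val "('l, 'c) val"
  | App "('l, 'c) trm" "('l, 'c) trm"
  | Mu "('l, 'c) trm"
  | Prc "('l, 'c) prc"
  | Proj "('l, 'c) val" 'l
  | Case "('l, 'c) val" "('c, ('l, 'c) trm) fmap"
  | Delta "('l, 'c) val" "('l, 'c) val"
and ('l, 'c) stk =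
    SVar nat
  | Push "('l, 'c) val" "('l, 'c) stk"
  | Frame "('l, 'c) trm" "('l, 'c) stk"
and ('l, 'c) prc =
    Cmd "('l, 'c) trm" "('l, 'c) stk"  (infix "\<star>" 60)

text \<open>Renaming of the free \<open>\<lambda>\<close>-variables along \<open>f\<close> and of the free stack variables along \<open>g\<close>;
  needed only to shift expressions that are moved under a binder.\<close>

definition up :: "(nat \<Rightarrow> nat) \<Rightarrow> nat \<Rightarrow> nat" where
  "up f n = (case n of 0 \<Rightarrow> 0 | Suc m \<Rightarrow> Suc (f m))"

primrec
  ren_val :: "('l, 'c) val \<Rightarrow> (nat \<Rightarrow> nat) \<Rightarrow> (nat \<Rightarrow> nat) \<Rightarrow> ('l, 'c) val" and
  ren_trm :: "('l, 'c) trm \<Rightarrow> (nat \<Rightarrow> nat) \<Rightarrow> (nat \<Rightarrow> nat) \<Rightarrow> ('l, 'c) trm" and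
  ren_stk :: "('l, 'c) stk \<Rightarrow> (nat \<Rightarrow> nat) \<Rightarrow> (nat \<Rightarrow> nat) \<Rightarrow> ('l, 'c) stk" and
  ren_prc :: "('l, 'c) prc \<Rightarrow> (nat \<Rightarrow> nat) \<Rightarrow> (nat \<Rightarrow> nat) \<Rightarrow> ('l, 'c) prc"
where
  "ren_val (LVar n) f g = LVar (f n)"
| "ren_val (Lam t) f g = Lam (ren_trm t (up f) g)"
| "ren_val (Con c v) f g = Con c (ren_val v f g)"
| "ren_val (Rcd r) f g = Rcd (fmmap (\<lambda>v. ren_val v f g) r)"
| "ren_trm (TVar n) f g = TVar n"
| "ren_trm (Val v) f g = Val (ren_val v f g)"
| "ren_trm (App t u) f g = App (ren_trm t f g) (ren_trm u f g)"
| "ren_trm (Mu t) f g = Mu (ren_trm t f (up g))"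
| "ren_trm (Prc p) f g = Prc (ren_prc p f g)"
| "ren_trm (Proj v l) f g = Proj (ren_val v f g) l"
| "ren_trm (Case v b) f g = Case (ren_val v f g) (fmmap (\<lambda>t. ren_trm t (up f) g) b)"
| "ren_trm (Delta v w) f g = Delta (ren_val v f g) (ren_val w f g)"
| "ren_stk (SVar n) f g = SVar (g n)"
| "ren_stk (Push v \<pi>) f g = Push (ren_val v f g) (ren_stk \<pi> f g)"
| "ren_stk (Frame t \<pi>) f g = Frame (ren_trm t f g) (ren_stk \<pi> f g)"
| "ren_prc (t \<star> \<pi>) f g = ren_trm t f g \<star> ren_stk \<pi> f g"

datatype ('l, 'c) subst =
  Subst (lsub: "nat \<Rightarrow> ('l, 'c) val") (ssub: "nat \<Rightarrow> ('l, 'c) stk") (tsub: "nat \<Rightarrow> ('l, 'c) trm")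

text \<open>Transport of a substitution under a \<open>\<lambda>\<close>-binder and under a \<open>\<mu>\<close>-binder: the bound variable is
  fixed, and the images of all three kinds of variables are shifted to avoid capture.\<close>

definition lift_lam :: "('l, 'c) subst \<Rightarrow> ('l, 'c) subst" where
  "lift_lam \<sigma> = Subst
     (\<lambda>n. case n of 0 \<Rightarrow> LVar 0 | Suc m \<Rightarrow> ren_val (lsub \<sigma> m) Suc id)
     (\<lambda>n. ren_stk (ssub \<sigma> n) Suc id)
     (\<lambda>n. ren_trm (tsub \<sigma> n) Suc id)"

definition lift_mu :: "('l, 'c) subst \<Rightarrow> ('l, 'c) subst" where
  "lift_mu \<sigma> = Subst
     (\<lambda>n. ren_val (lsub \<sigma> n) id Suc)
     (\<lambda>n. case n of 0 \<Rightarrow> SVar 0 | Suc m \<Rightarrow> ren_stk (ssub \<sigma> m) id Suc)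
     (\<lambda>n. ren_trm (tsub \<sigma> n) id Suc)"

primrec
  subst_val :: "('l, 'c) val \<Rightarrow> ('l, 'c) subst \<Rightarrow> ('l, 'c) val" and
  subst_trm :: "('l, 'c) trm \<Rightarrow> ('l, 'c) subst \<Rightarrow> ('l, 'c) trm" and
  subst_stk :: "('l, 'c) stk \<Rightarrow> ('l, 'c) subst \<Rightarrow> ('l, 'c) stk" and
  subst_prc :: "('l, 'c) prc \<Rightarrow> ('l, 'c) subst \<Rightarrow> ('l, 'c) prc"
where
  "subst_val (LVar n) \<sigma> = lsub \<sigma> n"
| "subst_val (Lam t) \<sigma> = Lam (subst_trm t (lift_lam \<sigma>))"
| "subst_val (Con c v) \<sigma> = Con c (subst_val v \<sigma>)"
| "subst_val (Rcd r) \<sigma> = Rcd (fmmap (\<lambda>v. subst_val v \<sigma>) r)"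
| "subst_trm (TVar n) \<sigma> = tsub \<sigma> n"
| "subst_trm (Val v) \<sigma> = Val (subst_val v \<sigma>)"
| "subst_trm (App t u) \<sigma> = App (subst_trm t \<sigma>) (subst_trm u \<sigma>)"
| "subst_trm (Mu t) \<sigma> = Mu (subst_trm t (lift_mu \<sigma>))"
| "subst_trm (Prc p) \<sigma> = Prc (subst_prc p \<sigma>)"
| "subst_trm (Proj v l) \<sigma> = Proj (subst_val v \<sigma>) l"
| "subst_trm (Case v b) \<sigma> = Case (subst_val v \<sigma>) (fmmap (\<lambda>t. subst_trm t (lift_lam \<sigma>)) b)"
| "subst_trm (Delta v w) \<sigma> = Delta (subst_val v \<sigma>) (subst_val w \<sigma>)"
| "subst_stk (SVar n) \<sigma> = ssub \<sigma> n"
| "subst_stk (Push v \<pi>) \<sigma> = Push (subst_val v \<sigma>) (subst_stk \<pi> \<sigma>)"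
| "subst_stk (Frame t \<pi>) \<sigma> = Frame (subst_trm t \<sigma>) (subst_stk \<pi> \<sigma>)"
| "subst_prc (t \<star> \<pi>) \<sigma> = subst_trm t \<sigma> \<star> subst_stk \<pi> \<sigma>"

text \<open>Instantiation of the variable bound by \<open>Lam\<close> (or by a branch of \<open>Case\<close>), resp. by \<open>Mu\<close>,
  when that binder is removed; hence the decrement of the other indices.\<close>

definition inst_lam :: "('l, 'c) val \<Rightarrow> ('l, 'c) subst" where
  "inst_lam v = Subst (\<lambda>n. case n of 0 \<Rightarrow> v | Suc m \<Rightarrow> LVar m) SVar TVar"

definition inst_mu :: "('l, 'c) stk \<Rightarrow> ('l, 'c) subst" where
  "inst_mu \<pi> = Subst LVar (\<lambda>n. case n of 0 \<Rightarrow> \<pi> | Suc m \<Rightarrow> SVar m) TVar"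

inductive red :: "('l, 'c) prc \<Rightarrow> ('l, 'c) prc \<Rightarrow> bool"  (infix "\<succ>" 50) where
  red_app: "App t u \<star> \<pi> \<succ> u \<star> Frame t \<pi>"
| red_frame: "Val v \<star> Frame t \<pi> \<succ> t \<star> Push v \<pi>"
| red_lam: "Val (Lam t) \<star> Push v \<pi> \<succ> subst_trm t (inst_lam v) \<star> \<pi>"
| red_mu: "Mu t \<star> \<pi> \<succ> subst_trm t (inst_mu \<pi>) \<star> \<pi>"
| red_prc: "Prc p \<star> \<pi> \<succ> p"
| red_proj: "fmlookup r l = Some v \<Longrightarrow> Proj (Rcd r) l \<star> \<pi> \<succ> Val v \<star> \<pi>"
| red_case: "fmlookup b c = Some t \<Longrightarrow> Case (Con c v) b \<star> \<pi> \<succ> subst_trm t (inst_lam v) \<star> \<pi>"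

definition final :: "('l, 'c) prc \<Rightarrow> bool" where
  "final p \<longleftrightarrow> (\<exists>v \<alpha>. p = Val v \<star> SVar \<alpha>)"

definition converges ::
  "(('l, 'c) prc \<Rightarrow> ('l, 'c) prc \<Rightarrow> bool) \<Rightarrow> ('l, 'c) prc \<Rightarrow> bool" where
  "converges R p \<longleftrightarrow> (\<exists>q. R\<^sup>*\<^sup>* p q \<and> final q)"

context
  notes conj_cong [fundef_cong]
begin

function step_at :: "nat \<Rightarrow> ('l, 'c) prc \<Rightarrow> ('l, 'c) prc \<Rightarrow> bool"
  and equiv_at :: "nat \<Rightarrow> ('l, 'c) trm \<Rightarrow> ('l, 'c) trm \<Rightarrow> bool"
where
  step_at_def: "step_at i = (\<lambda>p q. p \<succ> q \<or>
     (\<exists>v w \<pi>. p = Delta v w \<star> \<pi> \<and> q = Val v \<star> \<pi> \<and> (\<exists>j<i. \<not> equiv_at j (Val v) (Val w))))"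
| equiv_at_def: "equiv_at i = (\<lambda>t u. \<forall>j\<le>i. \<forall>\<pi> \<sigma>.
     converges (step_at j) (subst_trm t \<sigma> \<star> \<pi>) \<longleftrightarrow> converges (step_at j) (subst_trm u \<sigma> \<star> \<pi>))"
  by pat_completeness auto

end

termination
  by (relation "measure (case_sum (\<lambda>i. 2 * i) (\<lambda>i. 2 * i + 1))") auto

declare step_at_def [simp del] equiv_at_def [simp del]

definition step :: "('l, 'c) prc \<Rightarrow> ('l, 'c) prc \<Rightarrow> bool"  (infix "\<leadsto>" 50) where
  "p \<leadsto> q \<longleftrightarrow> (\<exists>i. step_at i p q)"

definition trm_equiv :: "('l, 'c) trm \<Rightarrow> ('l, 'c) trm \<Rightarrow> bool"  (infix "\<simeq>" 50) where
  "t \<simeq> u \<longleftrightarrow> (\<forall>i. equiv_at i t u)"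

end

theory Submission
  imports Defs
begin

text \<open>The relations \<open>step_at i\<close> increase with \<open>i\<close>, so a finite reduction sequence of \<open>\<leadsto>\<close>, being
  finite, already takes place at a single level.\<close>

text \<open>The level occurs only as the strict bound on the index that witnesses inequivalence in a
  \<open>Delta\<close> step, so a witness below \<open>i\<close> also serves at
  \<open>j\<close>.\<close>

lemma step_at_mono: "i \<le> j \<Longrightarrow> step_at i \<le> step_at j"
  unfolding step_at_def by (blast intro: less_le_trans)

lemma rtranclp_step_iff: "(\<leadsto>)\<^sup>*\<^sup>* p q \<longleftrightarrow> (\<exists>i. (step_at i)\<^sup>*\<^sup>* p q)"
proof
  assume "(\<leadsto>)\<^sup>*\<^sup>* p q"
  then show "\<exists>i. (step_at i)\<^sup>*\<^sup>* p q"
  proof induction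
    case base
    show ?case by blast
  next
    case (step q r)
    from step.IH obtain i where "(step_at i)\<^sup>*\<^sup>* p q" by blast
    moreover from step.hyps(2) obtain j where "step_at j q r" by (auto simp: step_def)
    \<comment> \<open>Monotonicity moves both the prefix and the last step to a common
      level.\<close>
    ultimately have "(step_at (max i j))\<^sup>*\<^sup>* p q" "step_at (max i j) q r"
      using rtranclp_mono[OF step_at_mono, of i "max i j"] step_at_mono[of j "max i j"] by auto
    then show ?case by (blast intro: rtranclp.rtrancl_into_rtrancl)
  qed
next
  have "step_at i \<le> (\<leadsto>)" for i :: nat
    by (auto simp: step_def)
  then show "(\<leadsto>)\<^sup>*\<^sup>* p q" if "\<exists>i. (step_at i)\<^sup>*\<^sup>* p q"
    using that rtranclp_mono by blast
qed

text \<open>Finality does not depend on the level, so only the reduction sequence matters.\<close>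

lemma converges_step_iff: "converges (\<leadsto>) p \<longleftrightarrow> (\<exists>i. converges (step_at i) p)"
  by (auto simp: converges_def rtranclp_step_iff)

theorem theorem1:
  fixes t u :: "('l :: countable, 'c :: countable) trm"
  assumes "t \<simeq> u"
  shows "\<forall>\<pi> \<sigma>. converges (\<leadsto>) (subst_trm t \<sigma> \<star> \<pi>) \<longleftrightarrow> converges (\<leadsto>) (subst_trm u \<sigma> \<star> \<pi>)"
proof -
  \<comment> \<open>This is the instance \<open>j = i\<close> of the bounded quantifier in
    \<open>equiv_at i\<close>. Both sides share the level, so the existential over levels carries
    over.\<close>
  have "converges (step_at i) (subst_trm t \<sigma> \<star> \<pi>) \<longleftrightarrow> converges (step_at i) (subst_trm u \<sigma> \<star> \<pi>)"
    for i \<sigma> \<pi>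
    using assms unfolding trm_equiv_def equiv_at_def by blast
  then show ?thesis
    by (simp add: converges_step_iff)
qed

end
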